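(* Let $n\in\{3,4\}$ and let $G$ be the $n\times n$ toroidal chess graph. Play Cops and Robbers on $G$ with every cop moving as a knight and the robber moving on foot. Then $c(G)=2$.
   Context: The $n\times n$ toroidal chess graph has vertex set $\mathbb{Z}_n\times\mathbb{Z}_n$, where $(i,j)$ is row $i$, column $j$; indices are taken mod $n$. Two vertices are adjacent if they differ by $\pm1$ in exactly one coordinate and agree in the other. Cops and Robbers with one robber is played as follows. The $k$ cops choose starting vertices (several cops may share a vertex), then the robber chooses a starting vertex. After that the cops and the robber alternate turns, cops first. On the cops' turn, each cop either stays where it is or moves to one of its allowable vertices. On the robber's turn, the robber either stays or moves to one of his allowable vertices. The cops win if, after finitely many moves, some cop occupies the robber's vertex. The robber wins if he can guarantee that this never happens. A player on foot at $(i,j)$ has as allowable vertices the four vertices adjacent to $(i,j)$. A player moving as a knight at $(i,j)$ has as allowable vertices $(i\pm1,j\pm2)$ and $(i\pm2,j\pm1)$ (all sign choices, mod $n$). The cop number $c(G)$ is the minimum number of cops for which the cops have a winning strategy, whatever the robber's starting position. *)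

theory Defs
  imports Main
begin

type_synonym vertex = "int \<times> int"

text \<open>Residues mod n are represented by the integers 0, ..., n - 1.\<close>

definition torus_vertices :: "nat \<Rightarrow> vertex set" where
  "torus_vertices n = {0..<int n} \<times> {0..<int n}"

definition cyclic_step :: "nat \<Rightarrow> int \<Rightarrow> int \<Rightarrow> bool" where
  "cyclic_step n a b \<longleftrightarrow> b = (a + 1) mod int n \<or> b = (a - 1) mod int n"

definition torus_adjacent :: "nat \<Rightarrow> vertex \<Rightarrow> vertex \<Rightarrow> bool" where
  "torus_adjacent n u v \<longleftrightarrow>
     u \<in> torus_vertices n \<and> v \<in> torus_vertices n \<and>
     (cyclic_step n (fst u) (fst v) \<and> snd u = snd v \<or>
      fst u = fst v \<and> cyclic_step n (snd u) (snd v))"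

definition foot_moves :: "nat \<Rightarrow> vertex \<Rightarrow> vertex set" where
  "foot_moves n u = {v. torus_adjacent n u v}"

definition knight_moves :: "nat \<Rightarrow> vertex \<Rightarrow> vertex set" where
  "knight_moves n u =
     {((fst u + a) mod int n, (snd u + b) mod int n) | a b.
        a \<in> {1, -1} \<and> b \<in> {2, -2} \<or> a \<in> {2, -2} \<and> b \<in> {1, -1}}"

text \<open>The game on a vertex set V. The functions C and R assign to each vertex of V the allowable
  vertices (in V) of a cop and of the robber standing there; staying put is always permitted in
  addition. A round consists of the cops' turn followed by the robber's turn; the choice of
  starting vertices is round 0. The vertex of the robber after round t is r t.\<close>

definition robber_play :: "'v set \<Rightarrow> ('v \<Rightarrow> 'v set) \<Rightarrow> (nat \<Rightarrow> 'v) \<Rightarrow> bool" where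
  "robber_play V R r \<longleftrightarrow> r 0 \<in> V \<and> (\<forall>t. r (Suc t) \<in> insert (r t) (R (r t)))"

text \<open>A strategy maps the list of all vertices the robber has occupied so far, oldest first, to
  the next positions of the cops 0, ..., k - 1; on the empty list it gives their starting vertices.
  The cops' own earlier positions are determined by the strategy and the robber's history, so
  they need not be arguments.\<close>

type_synonym 'v cop_strategy = "'v list \<Rightarrow> nat \<Rightarrow> 'v"

definition cop_position :: "'v cop_strategy \<Rightarrow> (nat \<Rightarrow> 'v) \<Rightarrow> nat \<Rightarrow> nat \<Rightarrow> 'v" where
  "cop_position \<sigma> r t i = \<sigma> (map r [0..<t]) i"

definition legal_cop_strategy ::
    "'v set \<Rightarrow> ('v \<Rightarrow> 'v set) \<Rightarrow> ('v \<Rightarrow> 'v set) \<Rightarrow> nat \<Rightarrow> 'v cop_strategy \<Rightarrow> bool" where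
  "legal_cop_strategy V C R k \<sigma> \<longleftrightarrow>
     (\<forall>i<k. \<sigma> [] i \<in> V) \<and>
     (\<forall>r. robber_play V R r \<longrightarrow>
        (\<forall>t. \<forall>i<k. cop_position \<sigma> r (Suc t) i
           \<in> insert (cop_position \<sigma> r t i) (C (cop_position \<sigma> r t i))))"

text \<open>Capture happens either on the robber's turn (or starting choice) of round t or on the cops'
  turn of round t + 1. Continuing the play after a capture does not affect the outcome.\<close>

definition captured :: "nat \<Rightarrow> 'v cop_strategy \<Rightarrow> (nat \<Rightarrow> 'v) \<Rightarrow> bool" where
  "captured k \<sigma> r \<longleftrightarrow>
     (\<exists>t. \<exists>i<k. cop_position \<sigma> r t i = r t \<or> cop_position \<sigma> r (Suc t) i = r t)"

definition cops_win :: "'v set \<Rightarrow> ('v \<Rightarrow> 'v set) \<Rightarrow> ('v \<Rightarrow> 'v set) \<Rightarrow> nat \<Rightarrow> bool" where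
  "cops_win V C R k \<longleftrightarrow>
     (\<exists>\<sigma>. legal_cop_strategy V C R k \<sigma> \<and> (\<forall>r. robber_play V R r \<longrightarrow> captured k \<sigma> r))"

text \<open>For finite V the minimum exists, since one cop on every vertex wins immediately.\<close>

definition cop_number :: "'v set \<Rightarrow> ('v \<Rightarrow> 'v set) \<Rightarrow> ('v \<Rightarrow> 'v set) \<Rightarrow> nat" where
  "cop_number V C R = (LEAST k. cops_win V C R k)"

end

theory Submission
  imports Defs
begin

text \<open>On these two boards every closed foot neighbourhood contains a vertex outside any
  given closed knight neighbourhood, so against one knight the robber can always move to a vertex
  that the knight does not threaten. Two knights starting on adjacent vertices can either capture at once
  or move so that together they threaten the whole closed foot neighbourhood of the robber,
  and then they capture on their second turn.\<close>

text \<open>Safety is an invariant: a robber whom no cop can reach on the coming cops' turn survives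
  it, and \<open>escape\<close> then offers him another such vertex. Closure of \<open>V\<close>
  under \<open>C\<close> and \<open>R\<close> keeps all positions where \<open>escape\<close>
  applies.\<close>

lemma not_cops_winI:
  assumes "V \<noteq> {}"
    and C: "\<And>u. u \<in> V \<Longrightarrow> C u \<subseteq> V" and R: "\<And>u. u \<in> V \<Longrightarrow> R u \<subseteq> V"
    and escape: "\<And>p r. \<lbrakk>\<forall>i<k. p i \<in> V; r \<in> V\<rbrakk> \<Longrightarrow>
      \<exists>s\<in>insert r (R r). \<forall>i<k. s \<notin> insert (p i) (C (p i))"
  shows "\<not> cops_win V C R k"
proof
  assume "cops_win V C R k"
  then obtain \<sigma> where legal: "legal_cop_strategy V C R k \<sigma>"
    and win: "\<And>r. robber_play V R r \<Longrightarrow> captured k \<sigma> r"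
    unfolding cops_win_def by blast
  define safe where "safe p s \<longleftrightarrow> (\<forall>i<k. s \<notin> insert (p i) (C (p i)))" for p s
  \<comment> \<open>The fallback makes every play legal for the robber, whether or not the cops play legally;
    legality of the cops is only known along legal plays of the robber.\<close>
  define g where "g p r = (if \<exists>s\<in>insert r (R r). safe p s
      then SOME s. s \<in> insert r (R r) \<and> safe p s else r)" for p r
  have g_in: "g p r \<in> insert r (R r)" for p r
  proof (cases "\<exists>s\<in>insert r (R r). safe p s")
    case True
    then have "\<exists>s. s \<in> insert r (R r) \<and> safe p s" by blast
    from someI_ex[OF this] show ?thesis using True by (simp add: g_def)
  qed (simp add: g_def)
  have g_safe: "safe p (g p r)" if "\<forall>i<k. p i \<in> V" "r \<in> V" for p r
  proof -
    have ex: "\<exists>s\<in>insert r (R r). safe p s"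
      using escape[OF that] by (simp add: safe_def)
    then have "\<exists>s. s \<in> insert r (R r) \<and> safe p s" by blast
    from someI_ex[OF this] show ?thesis using ex by (simp add: g_def)
  qed
  \<comment> \<open>\<open>v\<close> is a fictitious vertex before the game: the robber's choice of
    start is treated as a move from \<open>v\<close>.\<close>
  obtain v where "v \<in> V" using \<open>V \<noteq> {}\<close> by blast
  have start: "\<forall>i<k. \<sigma> [] i \<in> V" using legal by (simp add: legal_cop_strategy_def)
  \<comment> \<open>The cops read the entire history, so the recursion builds the history itself.
    \<open>h t\<close> lists \<open>r 0\<close>, ..., \<open>r t\<close>, hence
    \<open>\<sigma> (h t)\<close> is the cops' answer in round \<open>t + 1\<close>, which the
    robber sees before choosing \<open>r (Suc t)\<close>.\<close>
  define h where "h = rec_nat [g (\<sigma> []) v] (\<lambda>_ xs. xs @ [g (\<sigma> xs) (last xs)])"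
  define r where "r t = last (h t)" for t
  have r_0: "r 0 = g (\<sigma> []) v" by (simp add: r_def h_def)
  have r_Suc: "r (Suc t) = g (\<sigma> (h t)) (r t)" for t by (simp add: r_def h_def)
  have hist: "map r [0..<Suc t] = h t" for t
    by (induction t) (simp_all add: r_def h_def)
  have pos_Suc: "cop_position \<sigma> r (Suc t) = \<sigma> (h t)" for t
    by (rule ext) (simp only: cop_position_def hist)
  have r_V: "r t \<in> V" for t
  proof (induction t)
    case 0
    show ?case using g_in[of "\<sigma> []" v] R[OF \<open>v \<in> V\<close>] \<open>v \<in> V\<close> by (auto simp: r_0)
  next
    case (Suc t)
    show ?case using g_in[of "\<sigma> (h t)" "r t"] R[OF Suc] Suc by (auto simp: r_Suc)
  qed
  have play: "robber_play V R r"
    unfolding robber_play_def using r_V g_in by (simp add: r_Suc)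
  have step: "cop_position \<sigma> r (Suc t) i
      \<in> insert (cop_position \<sigma> r t i) (C (cop_position \<sigma> r t i))" if "i < k" for t i
    using legal play that unfolding legal_cop_strategy_def by blast
  have pos_V: "\<forall>i<k. cop_position \<sigma> r t i \<in> V" for t
  proof (induction t)
    case 0
    show ?case using start by (simp add: cop_position_def)
  next
    case (Suc t)
    show ?case
    proof (intro allI impI)
      fix i assume "i < k"
      then show "cop_position \<sigma> r (Suc t) i \<in> V"
        using step[of i t] C[of "cop_position \<sigma> r t i"] Suc by auto
    qed
  qed
  have "safe (cop_position \<sigma> r t) (r t)" for t
  proof (cases t)
    case 0
    have "cop_position \<sigma> r 0 = \<sigma> []" by (rule ext) (simp add: cop_position_def)
    with 0 show ?thesis using g_safe[OF start \<open>v \<in> V\<close>] by (simp add: r_0)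
  next
    case (Suc m)
    show ?thesis unfolding Suc pos_Suc r_Suc
      using g_safe[OF pos_V[of "Suc m"] r_V[of m]] by (simp only: pos_Suc)
  qed
  \<comment> \<open>Safety at \<open>t\<close> rules out both forms of capture: a cop already on
    \<open>r t\<close>, and, by \<open>step\<close>, a cop arriving there on the next cops'
    turn.\<close>
  then have "\<not> captured k \<sigma> r"
    unfolding captured_def safe_def by (metis step insertI1)
  with win[OF play] show False by blast
qed

text \<open>\<open>p\<close> is the cops' start and \<open>q\<close> their answer to the robber's
  start \<open>r\<close>: it either captures or leaves every possible reply \<open>s\<close> within
  reach of the second turn.\<close>

lemma cops_winI_two_turns:
  assumes start: "\<And>i. i < k \<Longrightarrow> p i \<in> V"
    and turn: "\<And>r. r \<in> V \<Longrightarrow> \<exists>q. (\<forall>i<k. q i \<in> insert (p i) (C (p i))) \<and>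
      ((\<exists>i<k. q i = r) \<or> (\<forall>s\<in>insert r (R r). \<exists>i<k. s \<in> insert (q i) (C (q i))))"
  shows "cops_win V C R k"
proof -
  obtain f where f_step: "\<And>r i. \<lbrakk>r \<in> V; i < k\<rbrakk> \<Longrightarrow> f r i \<in> insert (p i) (C (p i))"
    and f_win: "\<And>r. r \<in> V \<Longrightarrow> (\<exists>i<k. f r i = r) \<or>
      (\<forall>s\<in>insert r (R r). \<exists>i<k. s \<in> insert (f r i) (C (f r i)))"
    using turn by metis
  \<comment> \<open>On the second turn every cop that can jump onto \<open>s\<close> does so; the
    others stay, which also captures if one already stands on \<open>s\<close>. Later entries are
    ignored, so the cops stand still from then on.\<close>
  define \<sigma> where "\<sigma> xs = (case xs of [] \<Rightarrow> p | [r] \<Rightarrow> f r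
    | r # s # _ \<Rightarrow> (\<lambda>i. if s \<in> C (f r i) then s else f r i))" for xs
  have pos_0: "cop_position \<sigma> r 0 i = p i" for r i
    by (simp add: cop_position_def \<sigma>_def)
  have pos_1: "cop_position \<sigma> r (Suc 0) i = f (r 0) i" for r i
    by (simp add: cop_position_def \<sigma>_def)
  have pos_2: "cop_position \<sigma> r (Suc (Suc t)) i =
      (if r 1 \<in> C (f (r 0) i) then r 1 else f (r 0) i)" for r t i
    by (simp add: cop_position_def \<sigma>_def upt_conv_Cons del: upt_Suc)
  have "cop_position \<sigma> r (Suc t) i
      \<in> insert (cop_position \<sigma> r t i) (C (cop_position \<sigma> r t i))"
    if "robber_play V R r" "i < k" for r t i
  proof -
    have "r 0 \<in> V" using that by (simp add: robber_play_def)
    consider "t = 0" | "t = 1" | m where "t = Suc (Suc m)"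
      by (metis One_nat_def not0_implies_Suc)
    then show ?thesis
      by cases (use f_step[OF \<open>r 0 \<in> V\<close> \<open>i < k\<close>] in \<open>simp_all add: pos_0 pos_1 pos_2\<close>)
  qed
  then have "legal_cop_strategy V C R k \<sigma>"
    using start by (simp add: legal_cop_strategy_def \<sigma>_def)
  moreover have "captured k \<sigma> r" if play: "robber_play V R r" for r
  proof -
    have "r 0 \<in> V" and r1: "r 1 \<in> insert (r 0) (R (r 0))"
      using play by (auto simp: robber_play_def)
    from f_win[OF \<open>r 0 \<in> V\<close>] show ?thesis
    proof
      assume "\<exists>i<k. f (r 0) i = r 0"
      then show ?thesis unfolding captured_def using pos_1 by metis
    next
      assume "\<forall>s\<in>insert (r 0) (R (r 0)). \<exists>i<k. s \<in> insert (f (r 0) i) (C (f (r 0) i))"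
      then obtain i where "i < k" "r 1 \<in> insert (f (r 0) i) (C (f (r 0) i))"
        using r1 by blast
      \<comment> \<open>Either cop \<open>i\<close> jumps onto \<open>r 1\<close>, or it stays and
        the robber has walked into it.\<close>
      then have "cop_position \<sigma> r (Suc 1) i = r 1"
        using pos_2[of r 0 i] by auto
      then show ?thesis unfolding captured_def using \<open>i < k\<close> by blast
    qed
  qed
  ultimately show ?thesis unfolding cops_win_def by blast
qed

text \<open>Lists turn the claims about the two boards into finite checks that
  \<open>code_simp\<close> can evaluate.\<close>

definition torus_list :: "nat \<Rightarrow> vertex list" where
  "torus_list n = List.product [0..int n - 1] [0..int n - 1]"

text \<open>The head \<open>u\<close> stands for staying put. On small boards some offsets coincide
  mod \<open>n\<close>, which merely repeats entries.\<close>

definition knight_list :: "nat \<Rightarrow> vertex \<Rightarrow> vertex list" where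
  "knight_list n u = u # map (\<lambda>(a, b). ((fst u + a) mod int n, (snd u + b) mod int n))
     [(1, 2), (1, -2), (-1, 2), (-1, -2), (2, 1), (2, -1), (-2, 1), (-2, -1)]"

definition foot_list :: "nat \<Rightarrow> vertex \<Rightarrow> vertex list" where
  "foot_list n u = u # map (\<lambda>(a, b). ((fst u + a) mod int n, (snd u + b) mod int n))
     [(1, 0), (-1, 0), (0, 1), (0, -1)]"

lemma set_torus_list: "set (torus_list n) = torus_vertices n"
  by (auto simp: torus_list_def torus_vertices_def)

lemma set_knight_list: "set (knight_list n u) = insert u (knight_moves n u)"
proof -
  have "knight_moves n u = (\<lambda>(a, b). ((fst u + a) mod int n, (snd u + b) mod int n)) `
      ({1, -1} \<times> {2, -2} \<union> {2, -2} \<times> {1, -1})"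
    unfolding knight_moves_def by (rule set_eqI) (simp only: image_iff mem_Collect_eq Bex_def
      split_paired_Ex case_prod_conv Un_iff mem_Sigma_iff, blast)
  also have "{1, -1} \<times> {2, -2} \<union> {2, -2} \<times> {1, -1} =
      set [(1, 2), (1, -2), (-1, 2), (-1, -2), (2, 1), (2, -1), (-2, 1), (-2, -1 :: int)]"
    by auto
  finally show ?thesis by (simp only: knight_list_def list.set(2) set_map)
qed

lemma set_foot_list:
  assumes "u \<in> torus_vertices n"
  shows "set (foot_list n u) = insert u (foot_moves n u)"
proof -
  obtain i j where u: "u = (i, j)" by (cases u)
  have ij: "0 \<le> i" "i < int n" "0 \<le> j" "j < int n"
    using assms by (auto simp: u torus_vertices_def)
  then have "0 < int n" by linarith
  then have mod_in: "x mod int n \<in> {0..<int n}" for x by simp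
  \<comment> \<open>\<open>foot_list\<close> reduces the unchanged coordinate too, whereas
    \<open>torus_adjacent\<close> keeps it as it is.\<close>
  have "i mod int n = i" "j mod int n = j" using ij by simp_all
  have "foot_moves n u = {((i + 1) mod int n, j), ((i - 1) mod int n, j),
      (i, (j + 1) mod int n), (i, (j - 1) mod int n)}"
    using ij mod_in unfolding u foot_moves_def torus_adjacent_def cyclic_step_def torus_vertices_def
    by fastforce
  with \<open>i mod int n = i\<close> \<open>j mod int n = j\<close> show ?thesis
    by (simp add: u foot_list_def)
qed

lemma knight_moves_subset: "u \<in> torus_vertices n \<Longrightarrow> knight_moves n u \<subseteq> torus_vertices n"
  by (auto simp: knight_moves_def torus_vertices_def)

lemma foot_moves_subset: "foot_moves n u \<subseteq> torus_vertices n"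
  by (auto simp: foot_moves_def torus_adjacent_def)

text \<open>For \<open>n = 3\<close> a knight steps diagonally, so every row has an unthreatened
  vertex, and the robber reaches all of his row. For \<open>n = 4\<close> it threatens
  \<open>c\<close> and the foot neighbours of the antipode \<open>c + (2, 2)\<close>, which never
  include a whole closed foot neighbourhood. The proof checks all pairs.\<close>

lemma escape_one_knight:
  assumes "n \<in> {3, 4}" and c: "c \<in> torus_vertices n" and r: "r \<in> torus_vertices n"
  shows "\<exists>s\<in>insert r (foot_moves n r). s \<notin> insert c (knight_moves n c)"
proof -
  have "\<forall>c\<in>set (torus_list 3). \<forall>r\<in>set (torus_list 3).
    \<exists>s\<in>set (foot_list 3 r). s \<notin> set (knight_list 3 c)"
    by code_simp
  moreover have "\<forall>c\<in>set (torus_list 4). \<forall>r\<in>set (torus_list 4).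
    \<exists>s\<in>set (foot_list 4 r). s \<notin> set (knight_list 4 c)"
    by code_simp
  ultimately have "\<forall>c\<in>set (torus_list n). \<forall>r\<in>set (torus_list n).
    \<exists>s\<in>set (foot_list n r). s \<notin> set (knight_list n c)"
    using \<open>n \<in> {3, 4}\<close> by (elim insertE) simp_all
  then have "\<exists>s\<in>set (foot_list n r). s \<notin> set (knight_list n c)"
    using c r unfolding set_torus_list by blast
  then show ?thesis unfolding set_foot_list[OF r] set_knight_list .
qed

text \<open>For \<open>n = 3\<close> only \<open>r = (0, 2)\<close> avoids immediate capture, and
  \<open>a = (1, 1)\<close>, \<open>b = (0, 1)\<close> answer it. For \<open>n = 4\<close>, unless a
  capture is possible, one knight can reach the antipode \<open>r + (2, 2)\<close>, threatening all
  foot neighbours of \<open>r\<close>, and the other a foot neighbour of that antipode, threatening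
  \<open>r\<close>.\<close>

lemma two_knights_turn:
  assumes "n \<in> {3, 4}" and r: "r \<in> torus_vertices n"
  shows "\<exists>a\<in>insert (0, 0) (knight_moves n (0, 0)). \<exists>b\<in>insert (0, 1) (knight_moves n (0, 1)).
    a = r \<or> b = r \<or> (\<forall>s\<in>insert r (foot_moves n r).
      s \<in> insert a (knight_moves n a) \<or> s \<in> insert b (knight_moves n b))"
proof -
  have "\<forall>r\<in>set (torus_list 3).
    \<exists>a\<in>set (knight_list 3 (0, 0)). \<exists>b\<in>set (knight_list 3 (0, 1)). a = r \<or> b = r \<or>
      (\<forall>s\<in>set (foot_list 3 r). s \<in> set (knight_list 3 a) \<or> s \<in> set (knight_list 3 b))"
    by code_simp
  moreover have "\<forall>r\<in>set (torus_list 4).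
    \<exists>a\<in>set (knight_list 4 (0, 0)). \<exists>b\<in>set (knight_list 4 (0, 1)). a = r \<or> b = r \<or>
      (\<forall>s\<in>set (foot_list 4 r). s \<in> set (knight_list 4 a) \<or> s \<in> set (knight_list 4 b))"
    by code_simp
  ultimately have "\<forall>r\<in>set (torus_list n).
    \<exists>a\<in>set (knight_list n (0, 0)). \<exists>b\<in>set (knight_list n (0, 1)). a = r \<or> b = r \<or>
      (\<forall>s\<in>set (foot_list n r). s \<in> set (knight_list n a) \<or> s \<in> set (knight_list n b))"
    using \<open>n \<in> {3, 4}\<close> by (elim insertE) simp_all
  from this[unfolded set_torus_list, rule_format, OF r]
  show ?thesis unfolding set_foot_list[OF r] set_knight_list .
qed

theorem theorem1:
  fixes n :: nat
  assumes "n \<in> {3, 4}"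
  shows "cop_number (torus_vertices n) (knight_moves n) (foot_moves n) = 2"
  unfolding cop_number_def
proof (rule Least_equality)
  let ?V = "torus_vertices n"
  have V: "(0, 0) \<in> ?V" "(0, 1) \<in> ?V" using assms by (auto simp: torus_vertices_def)
  show "cops_win ?V (knight_moves n) (foot_moves n) 2"
  proof (rule cops_winI_two_turns)
    show "(if i = 0 then (0, 0) else (0, 1)) \<in> ?V" for i :: nat using V by simp
  next
    fix r assume "r \<in> ?V"
    then obtain a b where
      "a \<in> insert (0, 0) (knight_moves n (0, 0))" "b \<in> insert (0, 1) (knight_moves n (0, 1))"
      "a = r \<or> b = r \<or> (\<forall>s\<in>insert r (foot_moves n r).
        s \<in> insert a (knight_moves n a) \<or> s \<in> insert b (knight_moves n b))"
      using two_knights_turn[OF assms] by blast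
    then show "\<exists>q. (\<forall>i<2::nat. q i \<in> insert (if i = 0 then (0, 0) else (0, 1))
        (knight_moves n (if i = 0 then (0, 0) else (0, 1)))) \<and>
      ((\<exists>i<2::nat. q i = r) \<or>
       (\<forall>s\<in>insert r (foot_moves n r). \<exists>i<2::nat. s \<in> insert (q i) (knight_moves n (q i))))"
      by (intro exI[of _ "\<lambda>i::nat. if i = 0 then a else b"]) (auto simp: less_2_cases_iff)
  qed
next
  let ?V = "torus_vertices n"
  fix k assume win: "cops_win ?V (knight_moves n) (foot_moves n) k"
  show "2 \<le> k"
  proof (rule ccontr)
    assume "\<not> 2 \<le> k"
    then have k: "i = 0 \<and> k = 1" if "i < k" for i using that by simp
    have "\<not> cops_win ?V (knight_moves n) (foot_moves n) k"
    proof (rule not_cops_winI)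
      show "?V \<noteq> {}" using assms by (auto simp: torus_vertices_def)
    next
      fix p :: "nat \<Rightarrow> vertex" and r
      assume p: "\<forall>i<k. p i \<in> ?V" and r: "r \<in> ?V"
      \<comment> \<open>With no cops, \<open>r\<close> serves as a dummy knight position on the
        board, so \<open>k = 0\<close> and \<open>k = 1\<close> are treated together.\<close>
      define c where "c = (if k = 1 then p 0 else r)"
      have "c \<in> ?V" using p r by (simp add: c_def)
      then obtain s where "s \<in> insert r (foot_moves n r)" "s \<notin> insert c (knight_moves n c)"
        using escape_one_knight[OF assms] r by blast
      moreover have "p i = c" if "i < k" for i
        using k[OF that] by (simp add: c_def)
      ultimately show "\<exists>s\<in>insert r (foot_moves n r). \<forall>i<k. s \<notin> insert (p i) (knight_moves n (p i))"
        by blast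
    qed (simp_all add: knight_moves_subset foot_moves_subset)
    with win show False by blast
  qed
qed

end
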